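(* For each integer $n\ge 4$, $$\frac1n< V_n<\frac{2}{n+1},\qquad\text{where } V_n=\sup_{f\in\mathcal{K}}\big(|a_n(f)|-|a_{n+1}(f)|\big).$$
   Context: $\mathbb{D}$ is the open unit disk. $\mathcal{K}$ is the class of analytic univalent functions $f(z)=z+\sum_{n\ge2}a_n(f)z^n$ on $\mathbb{D}$ whose image $f(\mathbb{D})$ is convex. *)

theory Defs
  imports "HOL-Analysis.Analysis"
begin

definition convex_class :: "(complex \<Rightarrow> complex) set" where
  "convex_class = {f. f holomorphic_on ball 0 1 \<and> inj_on f (ball 0 1) \<and>
      f 0 = 0 \<and> deriv f 0 = 1 \<and> convex (f ` ball 0 1)}"

definition coeff_at0 :: "nat \<Rightarrow> (complex \<Rightarrow> complex) \<Rightarrow> complex" where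
  "coeff_at0 n f = (deriv ^^ n) f 0 / of_nat (fact n)"

text \<open>V_n, taken in the extended reals so that the supremum is always meaningful.\<close>
definition V :: "nat \<Rightarrow> ereal" where
  "V n = (SUP f\<in>convex_class. ereal (norm (coeff_at0 n f) - norm (coeff_at0 (Suc n) f)))"

end

theory Submission
  imports Defs "HOL-Complex_Analysis.Complex_Analysis"
begin

text \<open>For convex \<open>f\<close> the function \<open>p = 1 + z f''/f'\<close> has nonnegative real part, and the coefficients \<open>n a\<^sub>n\<close> of \<open>z f'\<close>
  come from those of \<open>p\<close> by exponentiation. The third Lebedev--Milin inequality, applied to \<open>(1 - w z) f'\<close>
  for a suitable \<open>|w| = 1\<close>, yields Leung's bound \<open>n |a\<^sub>n| - (n+1) |a\<^sub>n\<^sub>+\<^sub>1| \<le> 1\<close>, so the gap is at most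
  \<open>(|a\<^sub>n| + 1) / (n+1)\<close>. For the supremum to equal \<open>2/(n+1)\<close>, \<open>|a\<^sub>n|\<close> would have to approach \<open>1\<close>, which forces \<open>f\<close>
  towards a half-plane map, whose gap is \<open>0\<close>. The lower bound comes from maps onto a strip, for which
  \<open>a\<^sub>n = sin (n \<theta>) / (n sin \<theta>)\<close>, with \<open>\<theta>\<close> slightly less than \<open>\<pi>/(n+1)\<close>.\<close>

section \<open>Lebedev--Milin inequalities\<close>

text \<open>The recursion says that \<open>\<Sum> b\<^sub>m z\<^sup>m = exp (\<Sum> c\<^sub>k z\<^sup>k / k)\<close>, read off from the logarithmic derivative;
  the value \<open>c 0\<close> never matters.\<close>

definition log_exp_rec :: "(nat \<Rightarrow> complex) \<Rightarrow> (nat \<Rightarrow> complex) \<Rightarrow> bool" where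
  "log_exp_rec c b \<longleftrightarrow> b 0 = 1 \<and> (\<forall>m. of_nat m * b m = (\<Sum>k=1..m. c k * b (m - k)))"

lemma log_exp_rec_0: "log_exp_rec c b \<Longrightarrow> b 0 = 1"
  by (simp add: log_exp_rec_def)

lemma log_exp_rec_step:
  "log_exp_rec c b \<Longrightarrow> of_nat m * b m = (\<Sum>k=1..m. c k * b (m - k))"
  by (simp add: log_exp_rec_def)

lemma sum_lessThan_diff_eq:
  fixes g :: "nat \<Rightarrow> 'a::comm_monoid_add"
  shows "(\<Sum>k=1..m. g (m - k)) = (\<Sum>k<m. g k)"
  by (rule sum.reindex_bij_witness[of _ "\<lambda>k. m - k" "\<lambda>k. m - k"]) auto

text \<open>Cauchy-Schwarz on the recursion. It drives the induction for the second inequality and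
  the last step of the third.\<close>

lemma log_exp_rec_cauchy_schwarz:
  assumes "log_exp_rec c b"
  shows "(real m)\<^sup>2 * (cmod (b m))\<^sup>2 \<le> (\<Sum>k=1..m. (cmod (c k))\<^sup>2) * (\<Sum>k<m. (cmod (b k))\<^sup>2)"
proof -
  have "real m * cmod (b m) = cmod (\<Sum>k=1..m. c k * b (m - k))"
    by (metis log_exp_rec_step[OF assms] norm_mult norm_of_nat)
  also have "\<dots> \<le> (\<Sum>k=1..m. cmod (c k) * cmod (b (m - k)))"
    using norm_sum[of "\<lambda>k. c k * b (m - k)" "{1..m}"] by (simp add: norm_mult)
  finally have "(real m * cmod (b m))\<^sup>2 \<le> (\<Sum>k=1..m. cmod (c k) * cmod (b (m - k)))\<^sup>2"
    by (intro power_mono) auto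
  also have "\<dots> \<le> (\<Sum>k=1..m. (cmod (c k))\<^sup>2) * (\<Sum>k=1..m. (cmod (b (m - k)))\<^sup>2)"
    by (rule Cauchy_Schwarz_ineq_sum)
  also have "(\<Sum>k=1..m. (cmod (b (m - k)))\<^sup>2) = (\<Sum>k<m. (cmod (b k))\<^sup>2)"
    by (rule sum_lessThan_diff_eq)
  finally show ?thesis by (simp add: power_mult_distrib)
qed

text \<open>A new term multiplies the partial sum by at most \<open>1 + A / N\<^sup>2\<close>.
  Splitting off \<open>(N + 1) / N\<close> before using \<open>1 + x \<le> exp x\<close> keeps the
  bound sharp for \<open>c k = w ^ k\<close> with \<open>|w| = 1\<close>, where both sides are
  \<open>n + 1\<close>.\<close>

lemma lebedev_milin_second:
  assumes "log_exp_rec c b"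
  shows "(\<Sum>k\<le>n. (cmod (b k))\<^sup>2) \<le> real (n + 1) *
     exp ((\<Sum>k=1..n. (cmod (c k))\<^sup>2 / real k - 1 / (real k + 1)) - (\<Sum>k=1..n. (cmod (c k))\<^sup>2) / (real n + 1))"
proof (induction n)
  case 0
  then show ?case using log_exp_rec_0[OF assms] by simp
next
  case (Suc n)
  define A where "A = (\<Sum>k=1..Suc n. (cmod (c k))\<^sup>2)"
  define B where "B = (\<Sum>k\<le>n. (cmod (b k))\<^sup>2)"
  define x where "x = (cmod (c (Suc n)))\<^sup>2"
  define S where "S = (\<Sum>k=1..n. (cmod (c k))\<^sup>2 / real k - 1 / (real k + 1))"
  define N where "N = real n + 1"
  have N: "N > 0" by (simp add: N_def)
  have A': "(\<Sum>k=1..n. (cmod (c k))\<^sup>2) = A - x" by (simp add: A_def x_def)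
  have B0: "B \<ge> 0" unfolding B_def by (intro sum_nonneg) auto
  have IH: "B \<le> N * exp (S - (A - x) / N)"
    using Suc.IH unfolding A' by (simp add: B_def S_def N_def add.commute)
  have "N\<^sup>2 * (cmod (b (Suc n)))\<^sup>2 \<le> A * B"
    using log_exp_rec_cauchy_schwarz[OF assms, of "Suc n"]
    by (simp add: A_def B_def N_def lessThan_Suc_atMost add.commute)
  then have "(cmod (b (Suc n)))\<^sup>2 \<le> A * B / N\<^sup>2"
    using N by (simp add: field_simps)
  then have "(\<Sum>k\<le>Suc n. (cmod (b k))\<^sup>2) \<le> B * (1 + A / N\<^sup>2)"
    by (simp add: B_def algebra_simps)
  also have "1 + A / N\<^sup>2 = ((N + 1) / N) * (1 + (A - N) / (N * (N + 1)))"
    proof -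
    have "((N + 1) / N) * (1 + (A - N) / (N * (N + 1))) = (N + 1) / N + (A - N) / N\<^sup>2"
      using N by (simp add: divide_simps) (simp add: algebra_simps power2_eq_square)
    also have "\<dots> = 1 + A / N\<^sup>2"
      using N by (simp add: add_divide_distrib diff_divide_distrib power2_eq_square)
    finally show ?thesis ..
  qed
  also have "B * \<dots> \<le> B * (((N + 1) / N) * exp ((A - N) / (N * (N + 1))))"
    using B0 N by (intro mult_left_mono exp_ge_add_one_self) auto
  also have "\<dots> \<le> (N * exp (S - (A - x) / N)) * (((N + 1) / N) * exp ((A - N) / (N * (N + 1))))"
    using N by (intro mult_right_mono IH) auto
  also have "\<dots> = (N + 1) * exp (S - (A - x) / N + (A - N) / (N * (N + 1)))"
    using N by (simp add: exp_add)
  also have "S - (A - x) / N + (A - N) / (N * (N + 1)) = (S + (x / N - 1 / (N + 1))) - A / (N + 1)"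
    using N by (simp add: divide_simps) (simp add: algebra_simps)
  finally show ?case
    by (simp add: S_def x_def N_def A_def add_ac)
qed

text \<open>One more Cauchy-Schwarz step on top of the second inequality for \<open>n - 1\<close>;
  the leftover factor \<open>A / N\<close> is absorbed by
  \<open>x \<le> exp (x - 1)\<close>.\<close>

lemma lebedev_milin_third:
  assumes "log_exp_rec c b" "n \<ge> 1"
  shows "(cmod (b n))\<^sup>2 \<le> exp (\<Sum>k=1..n. ((cmod (c k))\<^sup>2 - 1) / real k)"
proof -
  obtain m where n: "n = Suc m" using assms(2) by (cases n) auto
  define A where "A = (\<Sum>k=1..n. (cmod (c k))\<^sup>2)"
  define x where "x = (cmod (c n))\<^sup>2"
  define N where "N = real n"
  define S where "S = (\<Sum>k=1..m. (cmod (c k))\<^sup>2 / real k - 1 / (real k + 1))"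
  have N: "N > 0" by (simp add: N_def n)
  have A0: "A \<ge> 0" unfolding A_def by (intro sum_nonneg) auto
  have A': "(\<Sum>k=1..m. (cmod (c k))\<^sup>2) = A - x" by (simp add: A_def x_def n)
  have "N\<^sup>2 * (cmod (b n))\<^sup>2 \<le> A * (\<Sum>k\<le>m. (cmod (b k))\<^sup>2)"
    using log_exp_rec_cauchy_schwarz[OF assms(1), of n]
    by (simp add: A_def N_def n lessThan_Suc_atMost)
  also have "\<dots> \<le> A * (N * exp (S - (A - x) / N))"
    using lebedev_milin_second[OF assms(1), of m] unfolding A'
    by (intro mult_left_mono A0) (simp add: S_def N_def n add_ac)
  finally have "(cmod (b n))\<^sup>2 \<le> (A / N) * exp (S - (A - x) / N)"
    using N by (simp add: field_simps power2_eq_square)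
  also have "\<dots> \<le> exp (A / N - 1) * exp (S - (A - x) / N)"
    using exp_ge_add_one_self[of "A / N - 1"] by (intro mult_right_mono) auto
  also have "\<dots> = exp (S + x / N - 1)"
    using N by (simp flip: exp_add) (simp add: field_simps)
  also have "S + x / N - 1 = (\<Sum>k=1..n. ((cmod (c k))\<^sup>2 - 1) / real k)"
  proof -
    \<comment> \<open>The shifted harmonic sum lacks its leading term 1; the \<open>- 1\<close> from
      \<open>exp (A / N - 1)\<close> makes up for it.\<close>
    have "(\<Sum>k=1..m. 1 / (real k + 1)) = (\<Sum>k=1..n. 1 / real k) - 1"
      unfolding n by (induction m) (auto simp: add_ac)
    moreover have "(\<Sum>k=1..m. (cmod (c k))\<^sup>2 / real k) + x / N = (\<Sum>k=1..n. (cmod (c k))\<^sup>2 / real k)"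
      by (simp add: x_def N_def n)
    ultimately show ?thesis
      by (simp add: S_def sum_subtractf diff_divide_distrib)
  qed
  finally show ?thesis .
qed

text \<open>Multiplying the series by \<open>1 - w z\<close> adds \<open>log (1 - w z)\<close>, that
  is minus the sum of \<open>w ^ k * z ^ k / k\<close>, to the exponent.\<close>

lemma log_exp_rec_times_linear:
  assumes "log_exp_rec p b"
  shows "log_exp_rec (\<lambda>k. p k - w ^ k) (\<lambda>m. if m = 0 then 1 else b m - w * b (m - 1))"
proof -
  define b' where "b' = (\<lambda>m. if m = 0 then 1 else b m - w * b (m - 1))"
  have b0: "b 0 = 1" using log_exp_rec_0[OF assms] .
  \<comment> \<open>Coefficientwise form of
    \<open>w z / (1 - w z) * ((1 - w z) B(z)) = w z B(z)\<close>, where \<open>B\<close> is the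
    series of \<open>b\<close>.\<close>
  have tel: "(\<Sum>k=1..m. w ^ k * b' (m - k)) = w * b (m - 1)" if "m \<ge> 1" for m
    using that
  proof (induction m rule: nat_induct_at_least)
    case base
    then show ?case by (simp add: b'_def b0)
  next
    case (Suc m)
    have "(\<Sum>k=1..Suc m. w ^ k * b' (Suc m - k)) = w * b' m + (\<Sum>k=1..m. w ^ Suc k * b' (m - k))"
      by (subst sum.atLeast_Suc_atMost) (auto simp: sum.shift_bounds_cl_Suc_ivl simp del: sum.cl_ivl_Suc)
    also have "(\<Sum>k=1..m. w ^ Suc k * b' (m - k)) = w * (w * b (m - 1))"
      unfolding Suc.IH[symmetric] by (simp add: sum_distrib_left mult_ac)
    finally show ?case using Suc.hyps by (simp add: b'_def algebra_simps)
  qed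
  have "of_nat m * b' m = (\<Sum>k=1..m. (p k - w ^ k) * b' (m - k))" for m
  proof (cases m)
    case 0
    then show ?thesis by simp
  next
    case (Suc l)
    have "(\<Sum>k=1..m. p k * b' (m - k)) = (\<Sum>k=1..m. p k * b (m - k)) - w * (\<Sum>k=1..l. p k * b (l - k))"
    proof -
      have "(\<Sum>k=1..l. p k * b' (m - k)) = (\<Sum>k=1..l. p k * b (m - k) - w * (p k * b (l - k)))"
        by (intro sum.cong refl) (auto simp: b'_def Suc algebra_simps Suc_diff_le)
      then show ?thesis
        by (simp add: Suc sum_subtractf sum_distrib_left b'_def b0)
    qed
    also have "\<dots> = of_nat m * b m - w * (of_nat l * b l)"
      by (simp only: log_exp_rec_step[OF assms])
    finally show ?thesis
      using tel[of m] by (simp add: left_diff_distrib sum_subtractf b'_def Suc algebra_simps)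
  qed
  then show ?thesis unfolding log_exp_rec_def b'_def by auto
qed

section \<open>Caratheodory sequences and coefficient gaps\<close>

text \<open>By the Herglotz representation, the \<open>P\<^sub>k / 2\<close> are the moments of a probability measure on the unit
  circle. Positivity on nonnegative trigonometric polynomials expresses this without the measure.\<close>

definition caratheodory_seq :: "(nat \<Rightarrow> complex) \<Rightarrow> bool" where
  "caratheodory_seq P \<longleftrightarrow> (\<forall>n c d.
     (\<forall>w. cmod w = 1 \<longrightarrow> 0 \<le> c + (\<Sum>k=1..n. Re (d k * w ^ k))) \<longrightarrow>
     0 \<le> c + (\<Sum>k=1..n. Re (d k * P k)) / 2)"

lemma caratheodory_seqD:
  assumes "caratheodory_seq P"
    and "\<And>w. cmod w = 1 \<Longrightarrow> 0 \<le> c + (\<Sum>k=1..n. Re (d k * w ^ k))"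
  shows "0 \<le> c + (\<Sum>k=1..n. Re (d k * P k)) / 2"
  using assms unfolding caratheodory_seq_def by blast

lemma exists_unimodular_mult_eq_norm: "\<exists>u. cmod u = 1 \<and> u * z = of_real (cmod z)"
proof (cases "z = 0")
  case True
  then show ?thesis by (intro exI[of _ 1]) auto
next
  case False
  then show ?thesis
    by (intro exI[of _ "cnj z / of_real (cmod z)"])
       (auto simp: norm_divide mult.commute[of "cnj z"] complex_norm_square[symmetric] power2_eq_square)
qed

text \<open>Test with \<open>1 - Re (u * w ^ k)\<close>, where the rotation \<open>u\<close> makes
  \<open>u * P k\<close> nonnegative.\<close>

lemma caratheodory_seq_norm_le:
  assumes "caratheodory_seq P" "k \<ge> 1"
  shows "cmod (P k) \<le> 2"
proof -
  obtain u where u: "cmod u = 1" "u * P k = of_real (cmod (P k))"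
    using exists_unimodular_mult_eq_norm by blast
  define d where "d = (\<lambda>j. if j = k then - u else 0)"
  have d: "(\<Sum>j=1..k. Re (d j * x j)) = - Re (u * x k)" for x
  proof -
    have "(\<Sum>j=1..k. Re (d j * x j)) = (\<Sum>j=1..k. if j = k then - Re (u * x j) else 0)"
      by (intro sum.cong) (auto simp: d_def)
    then show ?thesis using assms(2) by simp
  qed
  have "0 \<le> 1 + (\<Sum>j=1..k. Re (d j * P j)) / 2"
  proof (rule caratheodory_seqD[OF assms(1)])
    fix w :: complex assume "cmod w = 1"
    then have "Re (u * w ^ k) \<le> 1"
      using complex_Re_le_cmod[of "u * w ^ k"] u(1) by (simp add: norm_mult norm_power)
    then show "0 \<le> 1 + (\<Sum>j=1..k. Re (d j * w ^ j))" by (simp only: d)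
  qed
  then show ?thesis unfolding d u(2) by simp
qed

text \<open>The average of \<open>Q\<close> against the representing measure is \<open>\<Sum> |P\<^sub>k|\<^sup>2 / k\<close>, so the maximum of \<open>Q\<close> is at least
  that large, and at a maximum point the exponent in the Lebedev--Milin inequality is nonpositive.\<close>

lemma leung_successive_coefficients:
  assumes P: "caratheodory_seq P" and b: "log_exp_rec P b" and n: "n \<ge> 1"
  shows "cmod (b (n - 1)) - cmod (b n) \<le> 1"
proof -
  \<comment> \<open>\<open>Q w\<close> is the cross term in the sum of
    \<open>|P k - w ^ k|\<^sup>2 / k\<close>.\<close>
  define Q where "Q = (\<lambda>w. \<Sum>k=1..n. Re (2 * cnj (P k) / of_nat k * w ^ k))"
  have "continuous_on (sphere 0 1) Q"
    unfolding Q_def by (intro continuous_intros)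
  then obtain w where w: "cmod w = 1" and wmax: "\<And>v. cmod v = 1 \<Longrightarrow> Q v \<le> Q w"
    using continuous_attains_sup[of "sphere (0::complex) 1" Q] by (auto simp: dist_norm)
  \<comment> \<open>The test polynomial is \<open>Q w - Q v\<close> in the variable
    \<open>v\<close>, nonnegative because \<open>w\<close> is a maximum point.\<close>
  have "0 \<le> Q w + (\<Sum>k=1..n. Re (- (2 * cnj (P k) / of_nat k) * P k)) / 2"
  proof (rule caratheodory_seqD[OF P])
    fix v :: complex assume "cmod v = 1"
    then show "0 \<le> Q w + (\<Sum>k=1..n. Re (- (2 * cnj (P k) / of_nat k) * v ^ k))"
      using wmax[of v] by (simp add: Q_def sum_negf)
  qed
  moreover have "Re (- (2 * cnj (P k) / of_nat k) * P k) = - (2 * (cmod (P k))\<^sup>2 / real k)" for k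
  proof -
    have "- (2 * cnj (P k) / of_nat k) * P k = of_real (- (2 * (cmod (P k))\<^sup>2 / real k))"
      by (simp add: complex_norm_square mult_ac del: of_real_power)
    then show ?thesis by (metis Re_complex_of_real)
  qed
  ultimately have le: "(\<Sum>k=1..n. (cmod (P k))\<^sup>2 / real k) \<le> Q w"
    by (simp only: sum_negf sum_distrib_left[symmetric] times_divide_eq_right[symmetric])
  have "(cmod (P k - w ^ k))\<^sup>2 - 1 = (cmod (P k))\<^sup>2 - 2 * Re (cnj (P k) * w ^ k)" for k
  proof -
    have "(cmod (P k - w ^ k))\<^sup>2 = (cmod (P k))\<^sup>2 + (cmod (w ^ k))\<^sup>2 - 2 * Re (cnj (P k) * w ^ k)"
      by (simp only: cmod_power2) (simp add: power2_eq_square algebra_simps)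
    then show ?thesis using w by (simp add: norm_power)
  qed
  then have "(\<Sum>k=1..n. ((cmod (P k - w ^ k))\<^sup>2 - 1) / real k) =
      (\<Sum>k=1..n. (cmod (P k))\<^sup>2 / real k) - Q w"
    by (simp add: Q_def diff_divide_distrib sum_subtractf Re_divide_of_nat mult.assoc)
  also have "\<dots> \<le> 0" using le by simp
  finally have *: "exp (\<Sum>k=1..n. ((cmod (P k - w ^ k))\<^sup>2 - 1) / real k) \<le> 1" by simp
  have "(cmod (b n - w * b (n - 1)))\<^sup>2 \<le> 1"
    using order_trans[OF lebedev_milin_third[OF log_exp_rec_times_linear[OF b, of w] n] *] n by simp
  then have "cmod (b n - w * b (n - 1)) \<le> 1" by (simp add: power_le_one_iff)
  moreover have "cmod (w * b (n - 1)) - cmod (b n) \<le> cmod (b n - w * b (n - 1))"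
    by (metis norm_minus_commute norm_triangle_ineq2)
  ultimately show ?thesis using w by (simp add: norm_mult)
qed

text \<open>If \<open>|P\<^sub>1|\<close> is close to \<open>2\<close>, the representing measure is concentrated near one point \<open>v\<close>. The test polynomial
  comes from \<open>|v\<^sup>k - w\<^sup>k| \<le> k|v - w| \<le> k(s/2 + |v - w|\<^sup>2/(2s))\<close>, where \<open>|v - w|\<^sup>2\<close> is linear in \<open>w\<close>.\<close>

lemma caratheodory_seq_concentration:
  assumes P: "caratheodory_seq P" and s: "s > 0" and P1: "2 - 2 * s\<^sup>2 \<le> cmod (P 1)"
  shows "\<exists>v. cmod v = 1 \<and> (\<forall>k\<ge>1. cmod (P k - 2 * v ^ k) \<le> 3 * real k * s)"
proof -
  obtain z where z: "cmod z = 1" "z * P 1 = of_real (cmod (P 1))"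
    using exists_unimodular_mult_eq_norm by blast
  \<comment> \<open>The representing measure has \<open>Re (z * w)\<close> close to 1 on average, so
    its mass gathers near \<open>w = cnj z\<close>.\<close>
  define v where "v = cnj z"
  have v: "cmod v = 1" by (simp add: v_def z)
  have "cmod (P k - 2 * v ^ k) \<le> 3 * real k * s" if k: "k \<ge> 1" for k
  proof -
    obtain u where u: "cmod u = 1" "u * (v ^ k - P k / 2) = of_real (cmod (v ^ k - P k / 2))"
      using exists_unimodular_mult_eq_norm by blast
    \<comment> \<open>\<open>c\<close> and \<open>d\<close> encode
      \<open>k (s/2 + |v - w|\<^sup>2 / (2 s)) - Re (u * (v ^ k - w ^ k))\<close>. For
      \<open>k = 1\<close> both parts of \<open>d\<close> fall on the same index, hence the sum of
      two conditionals.\<close>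
    define c where "c = real k * (s / 2 + 1 / s) - Re (u * v ^ k)"
    define d where "d = (\<lambda>j. (if j = k then u else 0) + (if j = 1 then - (z * of_real (real k / s)) else 0))"
    have d: "(\<Sum>j=1..k. Re (d j * x j)) = Re (u * x k) - real k / s * Re (z * x 1)" for x
    proof -
      have "(\<Sum>j=1..k. Re (d j * x j)) = (\<Sum>j=1..k. if j = k then Re (u * x j) else 0) +
          (\<Sum>j=1..k. if j = 1 then - (real k / s * Re (z * x j)) else 0)"
        unfolding sum.distrib[symmetric]
        by (intro sum.cong) (auto simp: d_def algebra_simps)
      then show ?thesis using k by simp
    qed
    have "0 \<le> c + (\<Sum>j=1..k. Re (d j * P j)) / 2"
    proof (rule caratheodory_seqD[OF P])
      fix w :: complex assume w: "cmod w = 1"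
      define t where "t = cmod (v - w)"
      have "(cmod (v - w))\<^sup>2 = (cmod v)\<^sup>2 + (cmod w)\<^sup>2 - 2 * Re (cnj v * w)"
        by (simp only: cmod_power2) (simp add: power2_eq_square algebra_simps)
      then have t2: "t\<^sup>2 = 2 - 2 * Re (z * w)"
        using v w by (simp add: t_def v_def)
      have "Re (u * v ^ k) - Re (u * w ^ k) \<le> cmod (u * (v ^ k - w ^ k))"
        using complex_Re_le_cmod[of "u * (v ^ k - w ^ k)"] by (simp add: right_diff_distrib)
      also have "\<dots> \<le> real k * t"
        using norm_power_diff[of v w k] u(1) v w by (simp add: norm_mult t_def)
      also have "t \<le> s / 2 + t\<^sup>2 / (2 * s)"
        using sum_squares_ge_zero[of "t - s" 0] s
        by (simp add: field_simps power2_eq_square)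
      then have "real k * t \<le> real k * (s / 2 + t\<^sup>2 / (2 * s))"
        by (rule mult_left_mono) simp
      also have "\<dots> = real k * (s / 2 + 1 / s) - real k / s * Re (z * w)"
        unfolding t2 using s by (simp add: field_simps)
      finally show "0 \<le> c + (\<Sum>j=1..k. Re (d j * w ^ j))"
        unfolding d c_def by simp
    qed
    then have "cmod (v ^ k - P k / 2) \<le> real k * (s / 2 + 1 / s) - real k / s * cmod (P 1) / 2"
      using arg_cong[OF u(2), of Re] unfolding d c_def z(2)
      by (simp add: right_diff_distrib diff_divide_distrib)
    also have "\<dots> = real k * (s / 2) + real k / s * (1 - cmod (P 1) / 2)"
      by (simp add: algebra_simps)
    also have "\<dots> \<le> real k * (s / 2) + real k / s * s\<^sup>2"
      using P1 s by (intro add_left_mono mult_left_mono) auto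
    also have "\<dots> = 3 / 2 * real k * s"
      using s by (simp add: power2_eq_square)
    finally have "2 * cmod (v ^ k - P k / 2) \<le> 3 * real k * s" by simp
    moreover have "P k - 2 * v ^ k = - 2 * (v ^ k - P k / 2)" by simp
    then have "cmod (P k - 2 * v ^ k) = 2 * cmod (v ^ k - P k / 2)"
      by (metis norm_minus_cancel norm_mult norm_numeral)
    ultimately show ?thesis by simp
  qed
  then show ?thesis using v by blast
qed

section \<open>Growth and stability of the coefficients produced by the recursion\<close>

lemma sum_diff_Suc_eq: "(\<Sum>k=1..m. real (m - k) + 1) = real m * (real m + 1) / 2"
proof -
  have "(\<Sum>k=1..m. real (m - k) + 1) = (\<Sum>k<m. real k + 1)"
    by (rule sum_lessThan_diff_eq[of "\<lambda>k. real k + 1"])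
  also have "\<dots> = real m * (real m + 1) / 2"
    by (induction m) (auto simp: field_simps)
  finally show ?thesis .
qed

text \<open>The extreme case \<open>P k = 2\<close> yields \<open>b m = m + 1\<close>, the
  coefficients of \<open>1 / (1 - z)\<^sup>2\<close>, which is the derivative of the half-plane map
  \<open>z / (1 - z)\<close>.\<close>

lemma log_exp_rec_norm_le:
  assumes P: "\<And>k. k \<ge> 1 \<Longrightarrow> cmod (P k) \<le> 2" and b: "log_exp_rec P b"
  shows "cmod (b m) \<le> real m + 1"
proof (induction m rule: less_induct)
  case (less m)
  show ?case
  proof (cases "m = 0")
    case True
    then show ?thesis using log_exp_rec_0[OF b] by simp
  next
    case False
    have "real m * cmod (b m) = cmod (\<Sum>k=1..m. P k * b (m - k))"
      by (metis log_exp_rec_step[OF b] norm_mult norm_of_nat)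
    also have "\<dots> \<le> (\<Sum>k=1..m. 2 * (real (m - k) + 1))"
      using P less unfolding norm_mult
      by (intro sum_norm_le) (auto simp: norm_mult simp del: of_nat_diff distrib_left_numeral intro!: mult_mono)
    also have "\<dots> = real m * (real m + 1)"
      by (simp only: sum_distrib_left[symmetric] sum_diff_Suc_eq)
    finally show ?thesis using False by simp
  qed
qed

text \<open>Only the summands with \<open>k \<ge> 2\<close> are estimated by
  \<open>|P k| \<le> 2\<close>; a deficit of \<open>|P 1|\<close> below 2 thus passes in full to the
  bound on every \<open>|b m|\<close>.\<close>

lemma log_exp_rec_norm_le_first:
  assumes P: "\<And>k. k \<ge> 1 \<Longrightarrow> cmod (P k) \<le> 2" and b: "log_exp_rec P b" and m: "m \<ge> 1"
  shows "cmod (b m) \<le> real m - 1 + cmod (P 1)"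
proof -
  obtain l where l: "m = Suc l" using m by (cases m) auto
  have "real m * cmod (b m) = cmod (\<Sum>k=1..m. P k * b (m - k))"
    by (metis log_exp_rec_step[OF b] norm_mult norm_of_nat)
  also have "\<dots> \<le> (\<Sum>k=1..m. cmod (P k) * (real (m - k) + 1))"
    using log_exp_rec_norm_le[OF P b]
    by (intro sum_norm_le) (auto simp: norm_mult simp del: of_nat_diff intro!: mult_left_mono)
  also have "\<dots> = cmod (P 1) * real m + (\<Sum>k=2..m. cmod (P k) * (real (m - k) + 1))"
    using m by (subst sum.atLeast_Suc_atMost) (auto simp: numeral_2_eq_2 of_nat_diff)
  also have "\<dots> \<le> cmod (P 1) * real m + (\<Sum>k=2..m. 2 * (real (m - k) + 1))"
    using P by (intro add_left_mono sum_mono mult_right_mono) auto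
  also have "\<dots> = cmod (P 1) * real m + ((\<Sum>k=1..m. 2 * (real (m - k) + 1)) - 2 * real m)"
    using m by (subst (2) sum.atLeast_Suc_atMost) (auto simp: numeral_2_eq_2 of_nat_diff)
  also have "\<dots> = real m * (real m - 1 + cmod (P 1))"
    by (simp only: sum_distrib_left[symmetric] sum_diff_Suc_eq) (simp add: field_simps)
  finally show ?thesis using m by simp
qed

text \<open>The comparison series is \<open>1 / (1 - v z)\<^sup>2\<close>, for which
  \<open>P k = 2 * v ^ k\<close>; subtracting its recursion from that of \<open>b\<close> propagates
  the error.\<close>

lemma log_exp_rec_near_koebe:
  assumes P: "\<And>k. k \<ge> 1 \<Longrightarrow> cmod (P k) \<le> 2" and b: "log_exp_rec P b" and v: "cmod v = 1"
    and near: "\<And>k. 1 \<le> k \<Longrightarrow> k \<le> m \<Longrightarrow> cmod (P k - 2 * v ^ k) \<le> e" and e: "e \<ge> 0"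
  shows "cmod (b m - (of_nat m + 1) * v ^ m) \<le> real m * (real m + 1) / 2 * e"
  using near
proof (induction m rule: less_induct)
  case (less m)
  define D where "D = (\<lambda>m. b m - (of_nat m + 1) * v ^ m)"
  show ?case
  proof (cases "m = 0")
    case True
    then show ?thesis using log_exp_rec_0[OF b] by simp
  next
    case False
    have koebe: "(\<Sum>k=1..m. 2 * v ^ k * ((of_nat (m - k) + 1) * v ^ (m - k))) = of_nat m * ((of_nat m + 1) * v ^ m)"
    proof -
      have "(\<Sum>k=1..m. 2 * v ^ k * ((of_nat (m - k) + 1) * v ^ (m - k))) =
          (\<Sum>k=1..m. 2 * v ^ m * of_real (real (m - k) + 1))"
        by (intro sum.cong) (auto simp: mult_ac simp flip: power_add)
      also have "\<dots> = 2 * v ^ m * of_real (real m * (real m + 1) / 2)"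
        by (simp only: sum_distrib_left[symmetric] of_real_sum[symmetric] sum_diff_Suc_eq)
      finally show ?thesis by simp
    qed
    have "of_nat m * D m = (\<Sum>k=1..m. P k * b (m - k)) - (\<Sum>k=1..m. 2 * v ^ k * ((of_nat (m - k) + 1) * v ^ (m - k)))"
      unfolding D_def right_diff_distrib koebe log_exp_rec_step[OF b] ..
    \<comment> \<open>In this splitting the perturbation meets \<open>b\<close>, controlled by the
      growth bound, and the comparison coefficients meet \<open>D\<close>, controlled by
      induction.\<close>
    also have "\<dots> = (\<Sum>k=1..m. (P k - 2 * v ^ k) * b (m - k) + 2 * v ^ k * D (m - k))"
      unfolding sum_subtractf[symmetric] by (simp add: D_def algebra_simps)
    finally have "real m * cmod (D m) = cmod (\<Sum>k=1..m. (P k - 2 * v ^ k) * b (m - k) + 2 * v ^ k * D (m - k))"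
      by (metis norm_mult norm_of_nat)
    also have "\<dots> \<le> (\<Sum>k=1..m. e * (real (m - k) + 1) + 2 * (real (m - k) * (real (m - k) + 1) / 2 * e))"
    proof (rule sum_norm_le)
      fix k assume k: "k \<in> {1..m}"
      have "cmod ((P k - 2 * v ^ k) * b (m - k)) \<le> e * (real (m - k) + 1)"
        unfolding norm_mult using k less.prems e log_exp_rec_norm_le[OF P b, of "m - k"]
        by (intro mult_mono) (auto simp del: of_nat_diff)
      moreover have "cmod (D (m - k)) \<le> real (m - k) * (real (m - k) + 1) / 2 * e"
        unfolding D_def using k less.prems by (intro less.IH) auto
      then have "cmod (2 * v ^ k * D (m - k)) \<le> 2 * (real (m - k) * (real (m - k) + 1) / 2 * e)"
        by (simp add: norm_mult norm_power v)
      ultimately show "cmod ((P k - 2 * v ^ k) * b (m - k) + 2 * v ^ k * D (m - k)) \<le>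
          e * (real (m - k) + 1) + 2 * (real (m - k) * (real (m - k) + 1) / 2 * e)"
        by (meson add_mono norm_triangle_ineq order_trans)
    qed
    also have "\<dots> = e * (\<Sum>k=1..m. (real (m - k) + 1) * (real (m - k) + 1))"
      unfolding sum_distrib_left by (intro sum.cong) (auto simp: field_simps simp del: of_nat_diff)
    also have "(\<Sum>k=1..m. (real (m - k) + 1) * (real (m - k) + 1)) = (\<Sum>k<m. (real k + 1) * (real k + 1))"
      by (rule sum_lessThan_diff_eq[of "\<lambda>k. (real k + 1) * (real k + 1)"])
    also have "(\<Sum>k<m. (real k + 1) * (real k + 1)) \<le> real m * (real m * (real m + 1) / 2)"
    proof (induction m)
      case (Suc m)
      have e: "real (Suc m) * (real (Suc m) * (real (Suc m) + 1) / 2) =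
          real m * (real m * (real m + 1) / 2) + (real m + 1) * (real m + 1) + (real m * real m + real m) / 2"
        by (simp add: field_simps)
      have "(real m * real m + real m) / 2 \<ge> 0" by simp
      then show ?case unfolding e sum.lessThan_Suc using Suc by linarith
    qed simp
    then have "e * (\<Sum>k<m. (real k + 1) * (real k + 1)) \<le> e * (real m * (real m * (real m + 1) / 2))"
      using e by (rule mult_left_mono)
    finally have "real m * cmod (D m) \<le> real m * (real m * (real m + 1) / 2 * e)"
      by (simp add: mult_ac)
    then have "cmod (D m) \<le> real m * (real m + 1) / 2 * e"
      by (rule mult_left_le_imp_le) (use False in simp)
    then show ?thesis unfolding D_def .
  qed
qed

text \<open>\<open>K\<close> must not depend on the sequences, since strictness has to survive a
  supremum. If \<open>|P 1|\<close> is near 2, then \<open>|b n| \<ge> n\<close> and the gap is at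
  most \<open>1 / (n + 1)\<close>; otherwise \<open>|b (n - 1)|\<close> stays a fixed amount below
  \<open>n\<close> and Leung's bound suffices.\<close>

lemma coefficient_gap_uniform_bound:
  assumes n: "n \<ge> 2"
  shows "\<exists>K < 2 / (real n + 1). \<forall>P b. caratheodory_seq P \<longrightarrow> log_exp_rec P b \<longrightarrow>
    cmod (b (n - 1)) / real n - cmod (b n) / (real n + 1) \<le> K"
proof -
  \<comment> \<open>Chosen so that the stability error \<open>n (n + 1) / 2 * (3 n s)\<close> equals
    1.\<close>
  define s where "s = 2 / (3 * (real n)\<^sup>2 * (real n + 1))"
  have s: "s > 0" using n by (simp add: s_def)
  define K where "K = max (1 / (real n + 1)) ((2 - 2 * s\<^sup>2 / real n) / (real n + 1))"
  have "cmod (b (n - 1)) / real n - cmod (b n) / (real n + 1) \<le> K"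
    if P: "caratheodory_seq P" and b: "log_exp_rec P b" for P b
  proof (cases "2 - 2 * s\<^sup>2 \<le> cmod (P 1)")
    case True
    obtain v where v: "cmod v = 1" and near: "\<And>k. k \<ge> 1 \<Longrightarrow> cmod (P k - 2 * v ^ k) \<le> 3 * real k * s"
      using caratheodory_seq_concentration[OF P s True] by blast
    have "cmod (P k - 2 * v ^ k) \<le> 3 * real n * s" if "1 \<le> k" "k \<le> n" for k
      using order_trans[OF near[OF that(1)] mult_right_mono[of "3 * real k" "3 * real n" s]] that(2) s by simp
    then have "cmod (b n - (of_nat n + 1) * v ^ n) \<le> real n * (real n + 1) / 2 * (3 * real n * s)"
      using s by (intro log_exp_rec_near_koebe[OF caratheodory_seq_norm_le[OF P] b v]) auto
    also have "\<dots> = 1"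
    proof -
      have "real n \<noteq> 0" "real n + 1 \<noteq> 0" using n by auto
      then show ?thesis by (simp add: s_def power2_eq_square)
    qed
    finally have "cmod (b n - (of_nat n + 1) * v ^ n) \<le> 1" .
    moreover have "cmod ((of_nat n + 1) * v ^ n) = real n + 1"
      using v by (simp add: norm_mult norm_power) (metis norm_of_nat of_nat_Suc add.commute)
    moreover have "cmod ((of_nat n + 1) * v ^ n) - cmod (b n) \<le> cmod (b n - (of_nat n + 1) * v ^ n)"
      by (metis norm_minus_commute norm_triangle_ineq2)
    ultimately have "real n \<le> cmod (b n)" by linarith
    then have "real n / (real n + 1) \<le> cmod (b n) / (real n + 1)"
      by (intro divide_right_mono) auto
    moreover have "cmod (b (n - 1)) \<le> real n"
      using log_exp_rec_norm_le[OF caratheodory_seq_norm_le[OF P] b, of "n - 1"] n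
      by (simp add: of_nat_diff)
    then have "cmod (b (n - 1)) / real n \<le> 1" using n by simp
    moreover have "1 - real n / (real n + 1) = 1 / (real n + 1)" by (simp add: field_simps)
    ultimately show ?thesis unfolding K_def by linarith
  next
    case False
    \<comment> \<open>Here \<open>n \<ge> 2\<close> makes the index \<open>n - 1\<close> positive,
      so that \<open>P 1\<close> enters the bound.\<close>
    have 1: "cmod (b (n - 1)) \<le> real n - 2 * s\<^sup>2"
      using log_exp_rec_norm_le_first[OF caratheodory_seq_norm_le[OF P] b, of "n - 1"] n False
      by (simp add: of_nat_diff) linarith
    have 2: "cmod (b (n - 1)) - cmod (b n) \<le> 1"
      using leung_successive_coefficients[OF P b] n by simp
    have "cmod (b (n - 1)) / real n - cmod (b n) / (real n + 1) \<le>
        cmod (b (n - 1)) / real n - (cmod (b (n - 1)) - 1) / (real n + 1)"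
      using 2 by (intro diff_left_mono divide_right_mono) auto
    also have "\<dots> = (cmod (b (n - 1)) / real n + 1) / (real n + 1)"
      using n by (simp add: divide_simps) (simp add: algebra_simps)
    also have "\<dots> \<le> ((real n - 2 * s\<^sup>2) / real n + 1) / (real n + 1)"
      using 1 by (intro divide_right_mono add_right_mono) auto
    also have "\<dots> = (2 - 2 * s\<^sup>2 / real n) / (real n + 1)"
      using n by (simp add: diff_divide_distrib)
    finally show ?thesis unfolding K_def by linarith
  qed
  moreover have "K < 2 / (real n + 1)"
    using s n unfolding K_def max_less_iff_conj by (intro conjI divide_strict_right_mono) auto
  ultimately show ?thesis by blast
qed

section \<open>Functions with nonnegative real part\<close>

text \<open>Cauchy's formula and Cauchy's theorem on the circle of radius \<open>r\<close>,
  parametrised over the unit interval: Taylor coefficients on one side, vanishing Fourier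
  coefficients on the other.\<close>

lemma has_integral_circle_exp_coeff:
  assumes p: "p holomorphic_on ball 0 1" and r: "0 < r" "r < 1"
  shows "((\<lambda>x. p (of_real r * cis (2 * pi * x)) * cnj (cis (2 * pi * x)) ^ k) has_integral
      (deriv ^^ k) p 0 / fact k * of_real r ^ k) {0..1}" (is ?A)
    and "((\<lambda>x. p (of_real r * cis (2 * pi * x)) * cis (2 * pi * x) ^ Suc k) has_integral 0) {0..1}" (is ?B)
proof -
  have cp: "circlepath 0 r x = of_real r * cis (2 * pi * x)" for x
    by (simp add: circlepath cis_conv_exp mult_ac)
  have vd: "vector_derivative (circlepath 0 r) (at x within {0..1}) = 2 * of_real pi * \<i> * (of_real r * cis (2 * pi * x))"
    if "x \<in> {0..1}" for x
    using that by (simp add: vector_derivative_circlepath01 cis_conv_exp mult_ac)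
  have cb: "cball 0 r \<subseteq> ball (0::complex) 1" using r by auto
  have rc: "complex_of_real r \<noteq> 0" using r by simp
  have cont: "continuous_on (cball 0 r) p" and hol: "p holomorphic_on ball 0 r"
    using p cb by (auto intro!: holomorphic_on_imp_continuous_on elim!: holomorphic_on_subset)
  have "((\<lambda>u. p u / (u - 0) ^ Suc k) has_contour_integral (2 * pi * \<i> / fact k * (deriv ^^ k) p 0)) (circlepath 0 r)"
    using r by (intro Cauchy_has_contour_integral_higher_derivative_circlepath cont hol) auto
  then have "((\<lambda>x. p (of_real r * cis (2 * pi * x)) / (of_real r * cis (2 * pi * x)) ^ Suc k *
      (2 * of_real pi * \<i> * (of_real r * cis (2 * pi * x)))) has_integral (2 * pi * \<i> / fact k * (deriv ^^ k) p 0)) {0..1}"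
    unfolding has_contour_integral_def by (rule has_integral_eq[rotated]) (simp add: vd cp)
  from has_integral_mult_right[OF this, of "of_real r ^ k / (2 * of_real pi * \<i>)"]
  show ?A
    by (rule has_integral_eq[rotated, THEN has_integral_eq_rhs])
       (use rc in \<open>auto simp: field_simps cis_cnj power_inverse[symmetric] simp flip: cis_inverse\<close>)
  have "((\<lambda>u. p u * u ^ k) has_contour_integral 0) (circlepath 0 r)"
    by (rule Cauchy_theorem_convex_simple[where S="ball 0 1"])
       (use r in \<open>auto intro!: holomorphic_intros p\<close>)
  then have "((\<lambda>x. p (of_real r * cis (2 * pi * x)) * (of_real r * cis (2 * pi * x)) ^ k *
      (2 * of_real pi * \<i> * (of_real r * cis (2 * pi * x)))) has_integral 0) {0..1}"
    unfolding has_contour_integral_def by (rule has_integral_eq[rotated]) (simp add: vd cp)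
  from has_integral_mult_right[OF this, of "inverse (of_real r ^ Suc k * (2 * of_real pi * \<i>))"]
  show ?B
    by (rule has_integral_eq[rotated, THEN has_integral_eq_rhs])
       (use rc in \<open>auto simp: field_simps\<close>)
qed

text \<open>With \<open>q = cnj e ^ Suc k\<close>, \<open>Re a * Re (d * q)\<close> is the real part
  of \<open>(d * a * q + cnj d * a * cnj q) / 2\<close>; the first term integrates to a Taylor
  coefficient and the second to 0.\<close>

lemma has_integral_Re_circle:
  assumes p: "p holomorphic_on ball 0 1" and r: "0 < r" "r < 1"
  shows "((\<lambda>x. Re (p (of_real r * cis (2 * pi * x))) * Re (d * cnj (cis (2 * pi * x)) ^ Suc k))
     has_integral r ^ Suc k * Re (d * ((deriv ^^ Suc k) p 0 / fact (Suc k))) / 2) {0..1}"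
proof -
  let ?p = "\<lambda>x. p (of_real r * cis (2 * pi * x))" and ?e = "\<lambda>x. cis (2 * pi * x)"
  have "((\<lambda>x. (d * (?p x * cnj (?e x) ^ Suc k) + cnj d * (?p x * ?e x ^ Suc k)) / 2) has_integral
      (d * ((deriv ^^ Suc k) p 0 / fact (Suc k) * of_real r ^ Suc k) + cnj d * 0) / 2) {0..1}"
    by (intro has_integral_divide has_integral_add has_integral_mult_right
          has_integral_circle_exp_coeff[OF p r])
  then have "((\<lambda>x. Re ((d * (?p x * cnj (?e x) ^ Suc k) + cnj d * (?p x * ?e x ^ Suc k)) / 2)) has_integral
      Re ((d * ((deriv ^^ Suc k) p 0 / fact (Suc k) * of_real r ^ Suc k) + cnj d * 0) / 2)) {0..1}"
    by (rule has_integral_Re)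
  moreover have "Re ((d * (a * cnj e ^ Suc k) + cnj d * (a * e ^ Suc k)) / 2) = Re a * Re (d * cnj e ^ Suc k)" for a e
  proof -
    have "Re ((d * (a * q) + cnj d * (a * cnj q)) / 2) = Re a * Re (d * q)" for q
      by (simp add: field_simps)
    from this[of "cnj e ^ Suc k"] show ?thesis by simp
  qed
  moreover have "Re ((d * (a * of_real r ^ Suc k) + cnj d * 0) / 2) = r ^ Suc k * Re (d * a) / 2" for a
  proof -
    have "d * (a * of_real r ^ Suc k) = of_real (r ^ Suc k) * (d * a)" by simp
    then show ?thesis by (simp only:) simp
  qed
  ultimately show ?thesis by (simp only:)
qed

text \<open>Integrate \<open>Re p\<close> against the test polynomial over the circle of radius
  \<open>r\<close>, where the integrand is nonnegative, and let \<open>r\<close> tend to 1.\<close>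

lemma caratheodory_seq_taylor:
  assumes p: "p holomorphic_on ball 0 1" and pos: "\<And>z. cmod z < 1 \<Longrightarrow> Re (p z) \<ge> 0" and p0: "p 0 = 1"
  shows "caratheodory_seq (\<lambda>k. (deriv ^^ k) p 0 / fact k)"
  unfolding caratheodory_seq_def
proof (intro allI impI)
  fix n c d
  assume T: "\<forall>w. cmod w = 1 \<longrightarrow> 0 \<le> c + (\<Sum>k=1..n. Re (d k * w ^ k))"
  define P where "P = (\<lambda>k. (deriv ^^ k) p 0 / fact k)"
  have *: "0 \<le> c + (\<Sum>k=1..n. r ^ k * Re (d k * P k) / 2)" if r: "0 < r" "r < 1" for r :: real
  proof -
    \<comment> \<open>Taylor coefficients pair with conjugate exponentials, so the test polynomial
      is evaluated at the conjugate point, still of modulus 1.\<close>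
    let ?p = "\<lambda>x. p (of_real r * cis (2 * pi * x))" and ?w = "\<lambda>x. cnj (cis (2 * pi * x))"
    have 0: "((\<lambda>x. Re (?p x) * c) has_integral c) {0..1}"
      using has_integral_mult_left[OF has_integral_Re[OF has_integral_circle_exp_coeff(1)[OF p r, of 0]], of c] p0
      by simp
    have "((\<lambda>x. Re (?p x) * Re (d k * ?w x ^ k)) has_integral r ^ k * Re (d k * P k) / 2) {0..1}"
      if k: "k \<in> {1..n}" for k
    proof -
      obtain j where "k = Suc j" using k by (cases k) auto
      then show ?thesis using has_integral_Re_circle[OF p r, of "d k" j] by (simp only: P_def)
    qed
    then have "((\<lambda>x. Re (?p x) * c + (\<Sum>k=1..n. Re (?p x) * Re (d k * ?w x ^ k))) has_integral
        c + (\<Sum>k=1..n. r ^ k * Re (d k * P k) / 2)) {0..1}"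
      by (intro has_integral_add 0 has_integral_sum) auto
    moreover have "Re (?p x) * c + (\<Sum>k=1..n. Re (?p x) * Re (d k * ?w x ^ k)) =
        Re (?p x) * (c + (\<Sum>k=1..n. Re (d k * ?w x ^ k)))" for x
      by (simp only: distrib_left sum_distrib_left)
    ultimately have "((\<lambda>x. Re (?p x) * (c + (\<Sum>k=1..n. Re (d k * ?w x ^ k)))) has_integral
        c + (\<Sum>k=1..n. r ^ k * Re (d k * P k) / 2)) {0..1}"
      by (simp only:)
    then show ?thesis
    proof (rule has_integral_nonneg)
      fix x :: real
      show "0 \<le> Re (?p x) * (c + (\<Sum>k=1..n. Re (d k * ?w x ^ k)))"
        using T r by (intro mult_nonneg_nonneg pos) (auto simp: norm_mult)
    qed
  qed
  have "((\<lambda>r::real. c + (\<Sum>k=1..n. r ^ k * Re (d k * P k) / 2)) \<longlongrightarrow> c + (\<Sum>k=1..n. 1 ^ k * Re (d k * P k) / 2)) (at_left 1)"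
    by (intro tendsto_intros) auto
  moreover have "eventually (\<lambda>r::real. 0 \<le> c + (\<Sum>k=1..n. r ^ k * Re (d k * P k) / 2)) (at_left 1)"
  proof -
    have "eventually (\<lambda>r::real. r \<in> {0<..<1}) (at_left 1)"
      by (rule eventually_at_left_real) simp
    then show ?thesis by eventually_elim (use * in auto)
  qed
  ultimately have "0 \<le> c + (\<Sum>k=1..n. 1 ^ k * Re (d k * P k) / 2)"
    by (rule tendsto_lowerbound) simp
  then show "0 \<le> c + (\<Sum>k=1..n. Re (d k * ((deriv ^^ k) p 0 / fact k))) / 2"
    by (simp add: P_def sum_divide_distrib)
qed

section \<open>Convex functions and the upper bound\<close>

text \<open>Odd powers cancel in the symmetric difference \<open>H\<close>, whose constant term is
  removed too; its coefficient at 2 is twice that of \<open>g\<close>.\<close>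

lemma second_difference_limit:
  fixes g :: "complex \<Rightarrow> complex"
  assumes g: "g holomorphic_on S" and S: "open S" "0 \<in> S"
  shows "((\<lambda>t. (g t + g (- t) - 2 * g 0) / t\<^sup>2) \<longlongrightarrow> (deriv ^^ 2) g 0) (at 0)"
proof -
  define G where "G = fps_expansion g 0"
  have G: "g has_fps_expansion G"
    unfolding G_def using assms by blast
  define H where "H = G + fps_compose G (- fps_X) - fps_const (2 * g 0)"
  have "(\<lambda>t. g t + (g \<circ> uminus) t - 2 * g 0) has_fps_expansion H"
    unfolding H_def
    by (intro fps_expansion_intros G) (auto intro!: fps_expansion_intros)
  then have H: "(\<lambda>t. g t + g (- t) - 2 * g 0) has_fps_expansion H" by simp
  have nth: "fps_nth (fps_compose G (- fps_X)) k = (-1) ^ k * fps_nth G k" for k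
    by (simp add: fps_compose_uminus')
  have G0: "fps_nth G 0 = g 0" using has_fps_expansion_imp_0_eq_fps_nth_0[OF G] by simp
  have H01: "fps_nth H 0 = 0" "fps_nth H 1 = 0"
    by (simp_all add: H_def nth G0)
  \<comment> \<open>The zero series has subdegree 0, so the case \<open>H = 0\<close> is treated
    separately.\<close>
  have sub: "2 \<le> subdegree H" if "H \<noteq> 0"
  proof (rule subdegree_geI[OF that])
    fix i :: nat assume "i < 2"
    then show "fps_nth H i = 0" using H01 by (cases "i = 0") (auto simp: less_2_cases_iff)
  qed
  have H2: "fps_nth H 2 = (deriv ^^ 2) g 0"
    using fps_nth_fps_expansion[OF G, of 2] by (simp add: H_def nth mult.commute)
  show ?thesis
  proof (cases "H = 0")
    case True
    then have "eventually (\<lambda>t. g t + g (- t) - 2 * g 0 = 0) (nhds 0)"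
      using H by (simp add: has_fps_expansion_0_iff)
    then have "eventually (\<lambda>t. (g t + g (- t) - 2 * g 0) / t\<^sup>2 = 0) (at 0)"
      unfolding eventually_at_filter by (rule eventually_mono) simp
    moreover have "(deriv ^^ 2) g 0 = 0" using H2 True by simp
    ultimately show ?thesis by (simp only: tendsto_eventually)
  next
    case False
    have "(\<lambda>t. if t = 0 then fps_nth H 2 else (g t + g (- t) - 2 * g 0) / t ^ 2) has_fps_expansion fps_shift 2 H"
      by (rule has_fps_expansion_shift[OF H sub[OF False] refl])
    from has_fps_expansion_imp_tendsto_0[OF this]
    have "((\<lambda>t. if t = 0 then fps_nth H 2 else (g t + g (- t) - 2 * g 0) / t ^ 2) \<longlongrightarrow> fps_nth H 2) (at 0)"
      by (simp add: tendsto_nhds_iff)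
    then show ?thesis unfolding H2
      by (rule Lim_transform_eventually) (auto simp: eventually_at_filter)
  qed
qed

text \<open>Study's argument: for real \<open>t\<close> the mean of \<open>f(e\<^sup>i\<^sup>tz)\<close> and \<open>f(e\<^sup>-\<^sup>i\<^sup>tz)\<close> is subordinate to \<open>f\<close>, so
  Schwarz's lemma applies to its pullback under \<open>f\<close>; the second order term in \<open>t\<close> gives the claim.\<close>

lemma convex_class_Re_nonneg:
  assumes f: "f \<in> convex_class" and z: "cmod z < 1"
  shows "Re (1 + z * deriv (deriv f) z / deriv f z) \<ge> 0"
proof (cases "z = 0")
  case False
  have hol: "f holomorphic_on ball 0 1" and inj: "inj_on f (ball 0 1)" and f0: "f 0 = 0"
    and cvx: "convex (f ` ball 0 1)"
    using f by (auto simp: convex_class_def)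
  have df: "(f has_field_derivative deriv f u) (at u)" if "cmod u < 1" for u
    using hol that by (intro holomorphic_derivI[of f "ball 0 1"]) auto
  have ddf: "(deriv f has_field_derivative deriv (deriv f) u) (at u)" if "cmod u < 1" for u
    using hol that by (intro holomorphic_derivI[of "deriv f" "ball 0 1"] holomorphic_deriv) auto
  have f'z: "deriv f z \<noteq> 0"
    using holomorphic_injective_imp_regular[OF hol _ inj] z by simp
  obtain h where h: "h holomorphic_on (f ` ball 0 1)" "\<And>u. u \<in> ball 0 1 \<Longrightarrow> deriv f u * deriv h (f u) = 1"
      "\<And>u. u \<in> ball 0 1 \<Longrightarrow> h (f u) = u"
    using holomorphic_has_inverse[OF hol _ inj] by auto
  have op: "open (f ` ball 0 1)" by (rule open_mapping_thm3[OF hol _ inj]) simp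
  have dh: "(h has_field_derivative 1 / deriv f z) (at (f z))"
  proof -
    have "(h has_field_derivative deriv h (f z)) (at (f z))"
      using z by (intro holomorphic_derivI[OF h(1) op]) auto
    moreover have "deriv h (f z) = 1 / deriv f z" using h(2)[of z] z f'z by (simp add: field_simps)
    ultimately show ?thesis by simp
  qed
  define F where "F = (\<lambda>t::real. (f (z * cis t) + f (z * cis (- t))) / 2)"
  have schwarz: "cmod (h (F t)) \<le> cmod z" for t
  proof -
    \<comment> \<open>By convexity \<open>q\<close> stays in the image of \<open>f\<close>, so
      \<open>h \<circ> q\<close> maps the disk into itself and fixes 0; moreover
      \<open>q z = F t\<close>.\<close>
    define q where "q = (\<lambda>u. (f (u * cis t) + f (u * cis (- t))) / 2)"
    have q: "q u \<in> f ` ball 0 1" if "cmod u < 1" for u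
    proof -
      have "(1/2) *\<^sub>R f (u * cis t) + (1/2) *\<^sub>R f (u * cis (- t)) \<in> f ` ball 0 1"
        using that by (intro convexD[OF cvx]) (auto simp: norm_mult)
      then show ?thesis by (simp add: q_def scaleR_conv_of_real add_divide_distrib)
    qed
    have qhol: "q holomorphic_on ball 0 1"
    proof -
      have "(\<lambda>u. f (u * cis a)) holomorphic_on ball 0 1" for a
      proof -
        have "f \<circ> (\<lambda>u. u * cis a) holomorphic_on ball 0 1"
          by (rule holomorphic_on_compose_gen[OF _ hol]) (auto simp: norm_mult intro!: holomorphic_intros)
        then show ?thesis by (simp add: o_def)
      qed
      then show ?thesis unfolding q_def by (intro holomorphic_intros) auto
    qed
    have "cmod ((h \<circ> q) z) \<le> cmod z"
    proof (rule Schwarz_Lemma(1))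
      show "h \<circ> q holomorphic_on ball 0 1"
        using q by (intro holomorphic_on_compose_gen[OF qhol h(1)]) auto
      show "(h \<circ> q) 0 = 0" using h(3)[of 0] by (simp add: q_def f0)
      show "cmod ((h \<circ> q) u) < 1" if "cmod u < 1" for u
        using q[OF that] h(3) by auto
    qed (rule z)
    then show ?thesis by (simp add: q_def F_def)
  qed
  \<comment> \<open>The parameter is made complex so that the holomorphic second difference limit
    applies; it is restricted to real \<open>t\<close> afterwards.\<close>
  define \<psi> where "\<psi> = (\<lambda>t. f (z * exp (\<i> * t)))"
  define S where "S = (\<lambda>t. z * exp (\<i> * t)) -` ball 0 1"
  have S: "open S" "0 \<in> S"
    unfolding S_def using z by (auto intro!: open_vimage continuous_intros)
  have d1: "(\<psi> has_field_derivative deriv f (z * exp (\<i> * t)) * (z * (exp (\<i> * t) * \<i>))) (at t)" if "t \<in> S" for t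
    unfolding \<psi>_def using that
    by (intro DERIV_chain2[OF df]) (auto simp: S_def intro!: derivative_eq_intros)
  have holpsi: "\<psi> holomorphic_on S"
    using d1 S(1) by (auto simp: holomorphic_on_open)
  define L where "L = - (z * deriv f z + z\<^sup>2 * deriv (deriv f) z)"
  have "(deriv \<psi> has_field_derivative L) (at 0)"
  proof -
    have "((\<lambda>t. deriv f (z * exp (\<i> * t)) * (z * (exp (\<i> * t) * \<i>))) has_field_derivative L) (at 0)"
      using z by (auto intro!: derivative_eq_intros DERIV_chain2[OF ddf] simp: L_def power2_eq_square algebra_simps)
    moreover have "eventually (\<lambda>t. deriv f (z * exp (\<i> * t)) * (z * (exp (\<i> * t) * \<i>)) = deriv \<psi> t) (nhds 0)"
      using eventually_nhds_in_open[OF S] by eventually_elim (use d1 DERIV_imp_deriv in metis)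
    ultimately show ?thesis by (subst (asm) DERIV_cong_ev[OF refl _ refl]) auto
  qed
  then have L: "(deriv ^^ 2) \<psi> 0 = L"
    by (simp add: numeral_2_eq_2 DERIV_imp_deriv)
  have "((\<lambda>t::real. (\<psi> t + \<psi> (- t) - 2 * \<psi> 0) / (complex_of_real t)\<^sup>2) \<longlongrightarrow> L) (at 0)"
  proof -
    have "complex_of_real \<midarrow>0\<rightarrow> complex_of_real 0"
      by (intro tendsto_intros)
    then have "filterlim complex_of_real (at 0) (at 0)"
      by (auto simp: filterlim_at eventually_at_filter)
    then show ?thesis unfolding of_real_minus
      by (rule filterlim_compose[OF second_difference_limit[OF holpsi S, unfolded L]])
  qed
  then have "((\<lambda>t::real. (\<psi> t + \<psi> (- t) - 2 * \<psi> 0) / (complex_of_real t)\<^sup>2 / 2) \<longlongrightarrow> L / 2) (at 0)"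
    by (intro tendsto_intros) auto
  moreover have "(\<psi> t + \<psi> (- t) - 2 * \<psi> 0) / (complex_of_real t)\<^sup>2 / 2 = (F t - f z) / of_real (t\<^sup>2)" for t :: real
    by (simp add: \<psi>_def F_def cis_conv_exp divide_simps)
  ultimately have Flim: "((\<lambda>t::real. (F t - f z) / of_real (t\<^sup>2)) \<longlongrightarrow> L / 2) (at 0)"
    by simp
  have Fz: "F 0 = f z" by (simp add: F_def)
  have Fcont: "(F \<longlongrightarrow> f z) (at 0)"
  proof -
    have "isCont f z" using df[OF z] DERIV_isCont by blast
    then have "((\<lambda>t. f (z * cis t)) \<longlongrightarrow> f z) (at 0)" "((\<lambda>t. f (z * cis (- t))) \<longlongrightarrow> f z) (at 0)"
      by (auto intro!: isCont_tendsto_compose[of z f] tendsto_eq_intros)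
    then show ?thesis unfolding F_def by (auto intro!: tendsto_eq_intros)
  qed
  \<comment> \<open>The Caratheodory form of the derivative avoids dividing by
    \<open>F t - f z\<close>, which may vanish.\<close>
  obtain k where k: "\<And>w. h w - h (f z) = k w * (w - f z)" "isCont k (f z)" "k (f z) = 1 / deriv f z"
    using dh[unfolded CARAT_DERIV] by auto
  have "((\<lambda>t. k (F t) * ((F t - f z) / of_real (t\<^sup>2)) / z) \<longlongrightarrow> 1 / deriv f z * (L / 2) / z) (at 0)"
    using tendsto_divide[OF tendsto_mult[OF isCont_tendsto_compose[OF k(2) Fcont] Flim] tendsto_const False]
    unfolding k(3) .
  then have lim: "((\<lambda>t. Re (k (F t) * ((F t - f z) / of_real (t\<^sup>2)) / z)) \<longlongrightarrow> Re (1 / deriv f z * (L / 2) / z)) (at 0)"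
    by (rule tendsto_Re)
  have "Re (k (F t) * ((F t - f z) / of_real (t\<^sup>2)) / z) \<le> 0" for t
  proof -
    have "h (f z) = z" using h(3) z by simp
    then have eq: "k (F t) * ((F t - f z) / of_real (t\<^sup>2)) / z = (h (F t) / z - 1) / of_real (t\<^sup>2)"
      using k(1)[of "F t"] False by (simp add: field_simps)
    have "cmod (h (F t) / z) \<le> 1" using schwarz[of t] False by (simp add: norm_divide)
    then have "Re (h (F t) / z) \<le> 1" using complex_Re_le_cmod order_trans by blast
    then show ?thesis unfolding eq Re_divide_of_real by (simp add: divide_nonpos_nonneg)
  qed
  then have "Re (1 / deriv f z * (L / 2) / z) \<le> 0"
    by (intro tendsto_upperbound[OF lim]) auto
  moreover have "1 / deriv f z * (L / 2) / z = - (1 + z * deriv (deriv f) z / deriv f z) / 2"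
    unfolding L_def using False f'z by (simp add: field_simps power2_eq_square)
  ultimately have "Re (- (1 + z * deriv (deriv f) z / deriv f z) / 2) \<le> 0"
    by (simp only:)
  then show ?thesis by simp
qed simp

section \<open>Coefficients of convex functions and passage to the supremum\<close>

lemma coeff_at0_deriv:
  "coeff_at0 (Suc m) f = (deriv ^^ m) (deriv f) 0 / fact m / of_nat (Suc m)"
  unfolding coeff_at0_def funpow_Suc_right o_def by (simp add: algebra_simps)

lemma norm_coeff_at0_deriv:
  "n \<ge> 1 \<Longrightarrow> cmod (coeff_at0 n f) = cmod ((deriv ^^ (n - 1)) (deriv f) 0 / fact (n - 1)) / real n"
  by (cases n) (auto simp: coeff_at0_deriv norm_divide norm_mult simp del: of_nat_Suc)

text \<open>Compare coefficients in \<open>p f' = f' + z f''\<close>; the recursion concerns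
  \<open>f'\<close>, whose coefficients are \<open>(m + 1)\<close> times those of \<open>f\<close>
  at index \<open>m + 1\<close>.\<close>

lemma log_exp_rec_convex_class:
  assumes f: "f \<in> convex_class"
  defines "p \<equiv> (\<lambda>z. 1 + z * deriv (deriv f) z / deriv f z)"
  shows "caratheodory_seq (\<lambda>k. (deriv ^^ k) p 0 / fact k)"
    and "log_exp_rec (\<lambda>k. (deriv ^^ k) p 0 / fact k) (\<lambda>m. (deriv ^^ m) (deriv f) 0 / fact m)"
proof -
  have hol: "f holomorphic_on ball 0 1" and inj: "inj_on f (ball 0 1)" and f1: "deriv f 0 = 1"
    using f by (auto simp: convex_class_def)
  have nz: "deriv f z \<noteq> 0" if "z \<in> ball 0 1" for z
    using holomorphic_injective_imp_regular[OF hol _ inj that] by simp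
  have hol': "deriv f holomorphic_on ball 0 1" "deriv (deriv f) holomorphic_on ball 0 1"
    by (intro holomorphic_deriv hol open_ball)+
  have p: "p holomorphic_on ball 0 1"
    unfolding p_def using nz by (intro holomorphic_intros hol') auto
  then show "caratheodory_seq (\<lambda>k. (deriv ^^ k) p 0 / fact k)"
    using convex_class_Re_nonneg[OF f] by (intro caratheodory_seq_taylor) (auto simp: p_def)
  define G where "G = fps_expansion (deriv f) 0"
  define P where "P = fps_expansion p 0"
  have G: "deriv f has_fps_expansion G" and P: "p has_fps_expansion P"
    unfolding G_def P_def using hol' p by (intro has_fps_expansion_fps_expansion[of "ball 0 1"]; simp)+
  have "(\<lambda>z. p z * deriv f z) has_fps_expansion P * G"
    by (intro fps_expansion_intros P G)
  moreover have "(\<lambda>z. deriv f z + z * deriv (deriv f) z) has_fps_expansion G + fps_X * fps_deriv G"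
    by (intro fps_expansion_intros G)
  moreover have "eventually (\<lambda>z. p z * deriv f z = deriv f z + z * deriv (deriv f) z) (nhds 0)"
  proof -
    have "eventually (\<lambda>z. z \<in> ball 0 1) (nhds (0::complex))"
      by (intro eventually_nhds_in_open) auto
    then show ?thesis by (rule eventually_mono) (use nz in \<open>auto simp: p_def field_simps\<close>)
  qed
  ultimately have eq: "P * G = G + fps_X * fps_deriv G"
    using fps_expansion_unique_complex has_fps_expansion_cong by metis
  have Gn: "(deriv ^^ m) (deriv f) 0 / fact m = fps_nth G m" for m
    using fps_nth_fps_expansion[OF G] by simp
  have Pn: "(deriv ^^ m) p 0 / fact m = fps_nth P m" for m
    using fps_nth_fps_expansion[OF P] by simp
  have P0: "fps_nth P 0 = 1" using Pn[of 0] by (simp add: p_def)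
  have "of_nat m * fps_nth G m = (\<Sum>k=1..m. fps_nth P k * fps_nth G (m - k))" for m
  proof -
    \<comment> \<open>Because \<open>p 0 = 1\<close>, the term \<open>k = 0\<close> of the product
      cancels the extra \<open>fps_nth G m\<close>.\<close>
    have "fps_nth G m + of_nat m * fps_nth G m = fps_nth (P * G) m"
      unfolding eq by (cases m) simp_all
    also have "\<dots> = fps_nth G m + (\<Sum>k=1..m. fps_nth P k * fps_nth G (m - k))"
      by (simp add: fps_mult_nth sum.atLeast_Suc_atMost[of 0 m] P0)
    finally show ?thesis by simp
  qed
  moreover have "fps_nth G 0 = 1" using Gn[of 0] f1 by simp
  ultimately show "log_exp_rec (\<lambda>k. (deriv ^^ k) p 0 / fact k) (\<lambda>m. (deriv ^^ m) (deriv f) 0 / fact m)"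
    unfolding Gn Pn log_exp_rec_def by blast
qed

lemma V_less:
  assumes n: "n \<ge> 2"
  shows "V n < ereal (2 / (real n + 1))"
proof -
  obtain K where K: "K < 2 / (real n + 1)"
    "\<And>P b. caratheodory_seq P \<Longrightarrow> log_exp_rec P b \<Longrightarrow>
       cmod (b (n - 1)) / real n - cmod (b n) / (real n + 1) \<le> K"
    using coefficient_gap_uniform_bound[OF n] by blast
  have "cmod (coeff_at0 n f) - cmod (coeff_at0 (Suc n) f) \<le> K" if "f \<in> convex_class" for f
    using K(2)[OF log_exp_rec_convex_class[OF that]] n
    by (simp add: norm_coeff_at0_deriv add.commute)
  then have "V n \<le> ereal K" unfolding V_def by (intro SUP_least) simp
  then show ?thesis using K(1) by (simp add: order.strict_trans1)
qed

section \<open>Strip maps and the lower bound\<close>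

text \<open>For \<open>sin \<theta> > 0\<close> this is the Moebius involution that exchanges the
  unit disk and the upper half-plane and sends 0 to \<open>cis \<theta>\<close>.\<close>

definition half_plane_map :: "real \<Rightarrow> complex \<Rightarrow> complex" where
  "half_plane_map \<theta> z = (cis \<theta> - z) / (1 - cis \<theta> * z)"

lemma half_plane_map:
  fixes \<theta> :: real
  assumes s: "sin \<theta> > 0"
  defines "T \<equiv> half_plane_map \<theta>"
  shows "cmod z < 1 \<Longrightarrow> 0 < Im (T z)" and "0 < Im w \<Longrightarrow> cmod (T w) < 1"
    and "1 - cis \<theta> * z \<noteq> 0 \<Longrightarrow> T (T z) = z"
proof -
  show "0 < Im (T z)" if z: "cmod z < 1"
  proof -
    have nz: "1 - cis \<theta> * z \<noteq> 0"
      using z by (metis eq_iff_diff_eq_0 less_irrefl mult_1 norm_cis norm_mult norm_one)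
    have "(cmod z)\<^sup>2 < 1" using z by (simp add: power_less_one_iff)
    moreover have "Im ((cis \<theta> - z) * cnj (1 - cis \<theta> * z)) = sin \<theta> * (1 - (cmod z)\<^sup>2) "
      unfolding cmod_power2 using sin_cos_squared_add[of \<theta>]
      by (simp add: power2_eq_square) algebra
    ultimately have "Im ((cis \<theta> - z) * cnj (1 - cis \<theta> * z)) > 0" using s by simp
    moreover have "T z = ((cis \<theta> - z) * cnj (1 - cis \<theta> * z)) / of_real ((cmod (1 - cis \<theta> * z))\<^sup>2)"
      unfolding T_def half_plane_map_def by (subst complex_div_cnj) simp
    ultimately show ?thesis using nz by (simp only: Im_divide_of_real) simp
  qed
  show "cmod (T w) < 1" if w: "0 < Im w"
  proof -
    have "(cmod (1 - cis \<theta> * w))\<^sup>2 - (cmod (cis \<theta> - w))\<^sup>2 = 4 * sin \<theta> * Im w"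
      unfolding cmod_power2 using sin_cos_squared_add[of \<theta>]
      by (simp add: power2_eq_square) algebra
    also have "\<dots> > 0" using s w by simp
    finally have "cmod (cis \<theta> - w) < cmod (1 - cis \<theta> * w)"
      by (simp add: power_less_imp_less_base)
    then show ?thesis unfolding T_def half_plane_map_def norm_divide
      by (metis divide_less_eq_1_pos norm_ge_zero order.strict_trans1)
  qed
  show "T (T z) = z" if nz: "1 - cis \<theta> * z \<noteq> 0"
  proof -
    \<comment> \<open>Nondegeneracy of the Moebius map: its determinant is
      \<open>cis \<theta> * cis \<theta> - 1\<close>.\<close>
    have "cis \<theta> * cis \<theta> \<noteq> 1"
    proof
      assume "cis \<theta> * cis \<theta> = 1"
      then have "cis \<theta> = cnj (cis \<theta>)"
        by (metis cis_cnj cis_mult cis_zero mult.right_neutral mult.left_neutral add.right_inverse mult.assoc)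
      then show False using s by (simp add: complex_eq_iff)
    qed
    then have *: "1 - cis \<theta> * cis \<theta> \<noteq> 0" by simp
    have "cis \<theta> - T z = (cis \<theta> * (1 - cis \<theta> * z) - (cis \<theta> - z)) / (1 - cis \<theta> * z)"
      unfolding T_def half_plane_map_def using nz by (simp add: diff_divide_distrib)
    moreover have "1 - cis \<theta> * T z = ((1 - cis \<theta> * z) - cis \<theta> * (cis \<theta> - z)) / (1 - cis \<theta> * z)"
      unfolding T_def half_plane_map_def diff_divide_distrib[of "1 - cis \<theta> * z"] using nz by simp
    moreover have "cis \<theta> * (1 - cis \<theta> * z) - (cis \<theta> - z) = z * (1 - cis \<theta> * cis \<theta>)"
      "(1 - cis \<theta> * z) - cis \<theta> * (cis \<theta> - z) = 1 - cis \<theta> * cis \<theta>"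
      by (simp_all add: algebra_simps)
    moreover have "T (T z) = (cis \<theta> - T z) / (1 - cis \<theta> * T z)"
      by (simp add: T_def half_plane_map_def)
    ultimately show ?thesis using nz * by simp
  qed
qed

text \<open>\<open>Ln\<close> opens the half-plane to a strip of width \<open>pi\<close>; the affine
  normalisation gives value 0 and derivative 1 at the origin.\<close>

definition strip_map :: "real \<Rightarrow> complex \<Rightarrow> complex" where
  "strip_map \<theta> z = (Ln (half_plane_map \<theta> z) - \<i> * of_real \<theta>) / (2 * \<i> * complex_of_real (sin \<theta>))"

text \<open>The denominator is \<open>(1 - cis \<theta> * z) * (1 - cis (- \<theta>) * z)\<close>,
  so this derivative generates the Chebyshev values
  \<open>sin ((k + 1) * \<theta>) / sin \<theta>\<close>.\<close>

lemma has_field_derivative_strip_map: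
  assumes t: "0 < \<theta>" "\<theta> < pi" and z: "cmod z < 1"
  shows "(strip_map \<theta> has_field_derivative 1 / (1 - 2 * complex_of_real (cos \<theta>) * z + z\<^sup>2)) (at z)"
proof -
  have s: "sin \<theta> > 0" using t by (rule sin_gt_zero)
  define c where "c = cis \<theta>"
  have im: "Im ((c - z) / (1 - c * z)) > 0"
    using half_plane_map(1)[OF s z] by (simp add: c_def half_plane_map_def)
  then have nz: "1 - c * z \<noteq> 0" "c - z \<noteq> 0" by auto
  \<comment> \<open>Positive imaginary part keeps the argument of \<open>Ln\<close> off the branch
    cut.\<close>
  have notneg: "(c - z) / (1 - c * z) \<notin> \<real>\<^sub>\<le>\<^sub>0"
    using im by (auto simp: complex_nonpos_Reals_iff)
  have cc: "c * c - 1 = 2 * \<i> * complex_of_real (sin \<theta>) * c"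
  proof -
    have "(cos \<theta>)\<^sup>2 = 1 - (sin \<theta>)\<^sup>2" by (simp add: cos_squared_eq)
    then show ?thesis by (auto simp: c_def complex_eq_iff power2_eq_square algebra_simps)
  qed
  have den: "(1 - c * z) * (c - z) = c * (1 - 2 * complex_of_real (cos \<theta>) * z + z\<^sup>2)"
  proof -
    have "1 + c * c = 2 * complex_of_real (cos \<theta>) * c"
      using sin_cos_squared_add[of \<theta>] 
      by (auto simp: c_def complex_eq_iff power2_eq_square algebra_simps)
    then show ?thesis by (simp add: power2_eq_square) algebra
  qed
  have s0: "complex_of_real (sin \<theta>) \<noteq> 0" using s by simp
  have c0: "c \<noteq> 0" by (simp add: c_def)
  have "((\<lambda>z. (c - z) / (1 - c * z)) has_field_derivative (c * c - 1) / ((1 - c * z) * (1 - c * z))) (at z)"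
    using nz by (auto intro!: derivative_eq_intros simp: algebra_simps)
  from DERIV_cdivide[OF DERIV_diff[OF DERIV_chain2[OF has_field_derivative_Ln[OF notneg] this]
      DERIV_const[of "\<i> * of_real \<theta>"]], of "2 * \<i> * complex_of_real (sin \<theta>)"]
  have "((\<lambda>z. (Ln ((c - z) / (1 - c * z)) - \<i> * of_real \<theta>) / (2 * \<i> * complex_of_real (sin \<theta>))) has_field_derivative
      (inverse ((c - z) / (1 - c * z)) * ((c * c - 1) / ((1 - c * z) * (1 - c * z))) - 0) / (2 * \<i> * complex_of_real (sin \<theta>))) (at z)" .
  also have "inverse ((c - z) / (1 - c * z)) * ((c * c - 1) / ((1 - c * z) * (1 - c * z))) - 0 =
      (c * c - 1) / ((1 - c * z) * (c - z))"
    using nz by (simp add: divide_simps)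
  also have "\<dots> / (2 * \<i> * complex_of_real (sin \<theta>)) = 1 / (1 - 2 * complex_of_real (cos \<theta>) * z + z\<^sup>2)"
    unfolding cc den using s0 c0 by simp
  finally show ?thesis unfolding strip_map_def[abs_def] half_plane_map_def c_def .
qed

text \<open>The image is an affine image of a strip, hence convex; injectivity comes from
  \<open>exp\<close> and from the involution.\<close>

lemma strip_map_convex_class:
  assumes t: "0 < \<theta>" "\<theta> < pi"
  shows "strip_map \<theta> \<in> convex_class"
proof -
  have s: "sin \<theta> > 0" using t by (rule sin_gt_zero)
  define T where "T = half_plane_map \<theta>"
  note T = half_plane_map[OF s, folded T_def]
  have nz: "1 - cis \<theta> * z \<noteq> 0" if "cmod z < 1" for z
    using T(1)[OF that] by (auto simp: T_def half_plane_map_def)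
  define A where "A = (\<lambda>w. (w - \<i> * of_real \<theta>) / (2 * \<i> * complex_of_real (sin \<theta>)))"
  have f: "strip_map \<theta> = (\<lambda>z. A (Ln (T z)))"
    by (auto simp: strip_map_def A_def T_def)
  have hol: "strip_map \<theta> holomorphic_on ball 0 1"
    unfolding holomorphic_on_open[OF open_ball]
    using has_field_derivative_strip_map[OF t] by (metis mem_ball_0)
  have inj: "inj_on (strip_map \<theta>) (ball 0 1)"
  proof (rule inj_onI)
    fix x y assume xy: "x \<in> ball 0 1" "y \<in> ball 0 1" "strip_map \<theta> x = strip_map \<theta> y"
    then have "Ln (T x) = Ln (T y)" using s by (simp add: f A_def)
    moreover have "T x \<noteq> 0" "T y \<noteq> 0" using T(1)[of x] T(1)[of y] xy by auto
    ultimately have "T x = T y" by (metis exp_Ln)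
    then show "x = y" using T(3)[of x] T(3)[of y] nz xy by (metis mem_ball_0)
  qed
  have Timg: "T ` ball 0 1 = {w. 0 < Im w}"
  proof (intro equalityI subsetI)
    fix w assume w: "w \<in> {w. 0 < Im w}"
    have "1 - cis \<theta> * w \<noteq> 0"
    proof
      assume "1 - cis \<theta> * w = 0"
      then have "w = cnj (cis \<theta>)"
        by (metis cis_cnj cis_inverse eq_iff_diff_eq_0 inverse_unique)
      then show False using w s by simp
    qed
    then show "w \<in> T ` ball 0 1" using T(2)[of w] T(3)[of w] w by (intro image_eqI[of _ _ "T w"]) auto
  qed (use T(1) in auto)
  have Limg: "Ln ` {w. 0 < Im w} = {w. 0 < Im w \<and> Im w < pi}"
  proof (intro equalityI subsetI)
    fix v assume "v \<in> {w. 0 < Im w \<and> Im w < pi}"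
    then have "Ln (exp v) = v" "0 < Im (exp v)" by (auto simp: Im_exp sin_gt_zero)
    then show "v \<in> Ln ` {w. 0 < Im w}" by (metis imageI mem_Collect_eq)
  qed (auto simp: Im_Ln_pos_lt_imp)
  have "strip_map \<theta> ` ball 0 1 = A ` {w. 0 < Im w \<and> Im w < pi}"
    unfolding f Limg[symmetric] Timg[symmetric] by (simp add: image_image)
  also have "\<dots> = (\<lambda>w. - (\<i> * \<theta>) / (2 * \<i> * complex_of_real (sin \<theta>)) + w) ` (\<lambda>w. (1 / (2 * \<i> * complex_of_real (sin \<theta>))) * w) ` {w. 0 < Im w \<and> Im w < pi}"
    unfolding image_image by (intro image_cong) (auto simp: A_def diff_divide_distrib)
  finally have img: "strip_map \<theta> ` ball 0 1 = \<dots>" .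
  have "convex {w. 0 < Im w \<and> Im w < pi}"
    using convex_Int[OF convex_halfspace_Im_gt[of 0] convex_halfspace_Im_lt[of pi]] by (simp add: Int_def)
  then have "convex (strip_map \<theta> ` ball 0 1)"
    unfolding img by (intro convex_translation convex_linear_image linear_times) 
  moreover have "strip_map \<theta> 0 = 0"
    using t by (simp add: strip_map_def half_plane_map_def cis_conv_exp)
  moreover have "deriv (strip_map \<theta>) 0 = 1"
    using has_field_derivative_strip_map[OF t, of 0] by (simp add: DERIV_imp_deriv)
  ultimately show ?thesis unfolding convex_class_def using hol inj by auto
qed

text \<open>Clearing the denominator of the derivative gives a three-term recurrence, which the
  sines satisfy as well.\<close>

lemma coeff_at0_strip_map:
  assumes t: "0 < \<theta>" "\<theta> < pi"
  shows "coeff_at0 (Suc m) (strip_map \<theta>) = of_real (sin (real (Suc m) * \<theta>) / (real (Suc m) * sin \<theta>))"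
proof -
  have s: "sin \<theta> > 0" using t by (rule sin_gt_zero)
  let ?f = "strip_map \<theta>"
  have hol: "?f holomorphic_on ball 0 1"
    using strip_map_convex_class[OF t] by (simp add: convex_class_def)
  define G where "G = fps_expansion (deriv ?f) 0"
  have G: "deriv ?f has_fps_expansion G"
    unfolding G_def using hol by (intro has_fps_expansion_fps_expansion[of "ball 0 1"] holomorphic_deriv) auto
  define D where "D = 1 - fps_const (2 * complex_of_real (cos \<theta>)) * fps_X + fps_X ^ 2"
  have "(\<lambda>z. deriv ?f z * (1 - 2 * complex_of_real (cos \<theta>) * z + z\<^sup>2)) has_fps_expansion G * D"
    unfolding D_def by (intro fps_expansion_intros G)
  moreover have "eventually (\<lambda>z. deriv ?f z * (1 - 2 * complex_of_real (cos \<theta>) * z + z\<^sup>2) = 1) (nhds 0)"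
  proof -
    have "open {z. 1 - 2 * complex_of_real (cos \<theta>) * z + z\<^sup>2 \<noteq> 0}"
      by (intro open_Collect_neq continuous_intros)
    from eventually_nhds_in_open[OF this, of 0]
    have "eventually (\<lambda>z. 1 - 2 * complex_of_real (cos \<theta>) * z + z\<^sup>2 \<noteq> 0) (nhds 0)"
      by simp
    moreover have "eventually (\<lambda>z. z \<in> ball 0 1) (nhds (0::complex))"
      by (intro eventually_nhds_in_open) auto
    ultimately show ?thesis
      by eventually_elim (simp add: DERIV_imp_deriv[OF has_field_derivative_strip_map[OF t]])
  qed
  ultimately have "(\<lambda>z. 1) has_fps_expansion G * D"
    by (subst (asm) has_fps_expansion_cong[OF _ refl]) auto
  then have eq: "G * D = 1" using fps_expansion_unique_complex has_fps_expansion_1 by blast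
  have GD: "fps_nth (G * D) k = fps_nth G k - 2 * complex_of_real (cos \<theta>) * (if k = 0 then 0 else fps_nth G (k - 1)) +
      (if k < 2 then 0 else fps_nth G (k - 2))" for k
  proof -
    have "G * D = G - fps_const (2 * complex_of_real (cos \<theta>)) * (G * fps_X) + G * fps_X ^ 2"
      unfolding D_def by (simp add: algebra_simps)
    then show ?thesis by (simp add: fps_X_power_mult_right_nth)
  qed
  \<comment> \<open>The conditionals give 0 to coefficients of negative index, where natural
    subtraction would return index 0.\<close>
  have step: "fps_nth G k = 2 * complex_of_real (cos \<theta>) * (if k = 0 then 0 else fps_nth G (k - 1)) -
      (if k < 2 then 0 else fps_nth G (k - 2)) + (if k = 0 then 1 else 0)" for k
    using GD[of k] unfolding eq by (simp add: algebra_simps)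
  have "fps_nth G k = of_real (sin (real (Suc k) * \<theta>) / sin \<theta>)" for k
  proof (induction k rule: less_induct)
    case (less k)
    consider "k = 0" | "k = 1" | j where "k = Suc (Suc j)"
      by (metis One_nat_def not0_implies_Suc)
    then show ?case
    proof cases
      case 1
      then show ?thesis using step[of 0] s by simp
    next
      case 2
      then show ?thesis using step[of 1] step[of 0] s by (simp add: sin_double)
    next
      case (3 j)
      have "sin (real (Suc k) * \<theta>) + sin (real (Suc j) * \<theta>) = 2 * cos \<theta> * sin (real (Suc (Suc j)) * \<theta>)"
      proof -
        have "real (Suc k) * \<theta> = real (Suc (Suc j)) * \<theta> + \<theta>" "real (Suc j) * \<theta> = real (Suc (Suc j)) * \<theta> - \<theta>"
          by (simp_all add: 3 algebra_simps)
        then show ?thesis by (simp only: sin_add sin_diff) simp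
      qed
      then have "sin (real (Suc k) * \<theta>) / sin \<theta> =
          2 * cos \<theta> * (sin (real (Suc (Suc j)) * \<theta>) / sin \<theta>) - sin (real (Suc j) * \<theta>) / sin \<theta>"
        using s by (simp add: field_simps)
      then show ?thesis
        using step[of k] less.IH[of "Suc j"] less.IH[of j] 3 by simp
    qed
  qed
  then show ?thesis
    unfolding coeff_at0_deriv fps_nth_fps_expansion[OF G, of m, symmetric]
    by (simp add: mult.commute del: of_nat_Suc)
qed

lemma cos_ge_one_minus_half_square: "1 - x\<^sup>2 / 2 \<le> cos (x::real)"
proof -
  have "(sin (x / 2))\<^sup>2 \<le> (x / 2)\<^sup>2"
    using abs_sin_x_le_abs_x[of "x / 2"] abs_le_square_iff by blast
  then show ?thesis using cos_double_sin[of "x / 2"] by (simp add: power_divide)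
qed

text \<open>At \<open>\<theta>0 = \<pi>/(n+1)\<close> the strip map has \<open>a\<^sub>n = 1/n\<close> and \<open>a\<^sub>n\<^sub>+\<^sub>1 = 0\<close>. The gap decreases strictly at
  \<open>\<theta>0\<close> as soon as \<open>cos \<theta>0 > n/(n+1)\<close>, which holds because \<open>\<pi>\<^sup>2/2 < 5 \<le> n+1\<close>; hence a slightly smaller
  angle beats \<open>1/n\<close>.\<close>

lemma V_greater:
  assumes n: "n \<ge> 4"
  shows "ereal (1 / real n) < V n"
proof -
  define N where "N = real n"
  have N: "N \<ge> 4" using n by (simp add: N_def)
  define \<theta>0 where "\<theta>0 = pi / (N + 1)"
  have Nt: "(N + 1) * \<theta>0 = pi" "N * \<theta>0 = pi - \<theta>0" using N by (simp_all add: \<theta>0_def field_simps)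
  have t0: "0 < \<theta>0" "\<theta>0 < pi" using N by (simp_all add: \<theta>0_def field_simps)
  then have s0: "sin \<theta>0 > 0" by (rule sin_gt_zero)
  \<comment> \<open>\<open>E\<close> is the coefficient gap of \<open>strip_map \<theta>\<close>
    with absolute values dropped, valid where both sines are nonnegative.\<close>
  define E where "E = (\<lambda>\<theta>. sin (N * \<theta>) / (N * sin \<theta>) - sin ((N + 1) * \<theta>) / ((N + 1) * sin \<theta>))"
  have "(E has_real_derivative
      (N * cos (N * \<theta>0) * (N * sin \<theta>0) - sin (N * \<theta>0) * (N * cos \<theta>0)) / ((N * sin \<theta>0) * (N * sin \<theta>0)) -
      ((N + 1) * cos ((N + 1) * \<theta>0) * ((N + 1) * sin \<theta>0) - sin ((N + 1) * \<theta>0) * ((N + 1) * cos \<theta>0)) / (((N + 1) * sin \<theta>0) * ((N + 1) * sin \<theta>0))) (at \<theta>0)"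
    unfolding E_def using s0 N by (auto intro!: derivative_eq_intros simp: mult_ac)
  also have "(N * cos (N * \<theta>0) * (N * sin \<theta>0) - sin (N * \<theta>0) * (N * cos \<theta>0)) / ((N * sin \<theta>0) * (N * sin \<theta>0)) =
      - (N + 1) * cos \<theta>0 / (N * sin \<theta>0)"
    unfolding Nt cos_pi_minus sin_pi_minus using s0 N by (simp add: field_simps)
  also have "((N + 1) * cos ((N + 1) * \<theta>0) * ((N + 1) * sin \<theta>0) - sin ((N + 1) * \<theta>0) * ((N + 1) * cos \<theta>0)) / (((N + 1) * sin \<theta>0) * ((N + 1) * sin \<theta>0)) =
      - 1 / sin \<theta>0"
  proof -
    have *: "(M * cos pi * (M * s) - sin pi * (M * c)) / (M * s * (M * s)) = - 1 / s"
      if "M > 0" "s > 0" for M s c :: real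
      using that by (simp add: field_simps)
    show ?thesis unfolding Nt by (rule *) (use s0 N in auto)
  qed
  finally have dE: "(E has_real_derivative - (N + 1) * cos \<theta>0 / (N * sin \<theta>0) - - 1 / sin \<theta>0) (at \<theta>0)" .
  have cos_gt: "(N + 1) * cos \<theta>0 > N"
  proof -
    \<comment> \<open>Half of \<open>3.15\<^sup>2\<close> is still below 5, and
      \<open>N + 1 \<ge> 5\<close>.\<close>
    have "pi * pi \<le> 3.15 * 3.15"
      by (intro mult_mono) (use pi_approx in auto)
    then have "\<theta>0 * pi / 2 < 1"
      using N by (simp add: \<theta>0_def field_simps)
    moreover have "\<theta>0\<^sup>2 / 2 * (N + 1) = \<theta>0 * ((N + 1) * \<theta>0) / 2"
      by (simp add: power2_eq_square)
    ultimately have "\<theta>0\<^sup>2 / 2 * (N + 1) < 1" unfolding Nt by simp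
    moreover have "(N + 1) * cos \<theta>0 \<ge> (N + 1) * (1 - \<theta>0\<^sup>2 / 2)"
      using cos_ge_one_minus_half_square[of \<theta>0] N by (intro mult_left_mono) auto
    moreover have "(N + 1) * (1 - \<theta>0\<^sup>2 / 2) = N + 1 - \<theta>0\<^sup>2 / 2 * (N + 1)"
      by (simp add: algebra_simps)
    ultimately show ?thesis by linarith
  qed
  have "- (N + 1) * cos \<theta>0 / (N * sin \<theta>0) - - 1 / sin \<theta>0 = (N - (N + 1) * cos \<theta>0) / (N * sin \<theta>0)"
    using N s0 by (simp add: field_simps)
  also have "\<dots> < 0"
    using cos_gt N s0 by (simp add: divide_neg_pos)
  finally obtain d where d: "d > 0" "\<And>h. 0 < h \<Longrightarrow> h < d \<Longrightarrow> E \<theta>0 < E (\<theta>0 - h)"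
    using DERIV_neg_dec_left[OF dE] by blast
  \<comment> \<open>Halving the minimum keeps \<open>\<theta>\<close> positive and within the range
    where \<open>E\<close> exceeds its value at \<open>\<theta>0\<close>.\<close>
  define h where "h = min d \<theta>0 / 2"
  define \<theta> where "\<theta> = \<theta>0 - h"
  have h: "0 < h" "h < d" "h < \<theta>0" using d t0 by (auto simp: h_def min_def)
  have t: "0 < \<theta>" "\<theta> < \<theta>0" "\<theta> < pi" using h t0 by (auto simp: \<theta>_def)
  have s: "sin \<theta> > 0" using t by (intro sin_gt_zero) auto
  have "(N + 1) * \<theta> < (N + 1) * \<theta>0" "N * \<theta> < N * \<theta>0"
    using t N by (auto intro!: mult_strict_left_mono)
  \<comment> \<open>Both angles lie between 0 and \<open>pi\<close>, because
    \<open>(N + 1) * \<theta>0 = pi\<close>.\<close>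
  then have "sin ((N + 1) * \<theta>) \<ge> 0" "sin (N * \<theta>) \<ge> 0"
    unfolding Nt using t t0 N by (auto intro!: sin_ge_zero)
  then have val: "cmod (coeff_at0 n (strip_map \<theta>)) - cmod (coeff_at0 (Suc n) (strip_map \<theta>)) = E \<theta>"
  proof -
    assume sn: "sin ((N + 1) * \<theta>) \<ge> 0" "sin (N * \<theta>) \<ge> 0"
    obtain m where m: "n = Suc m" using n by (cases n) auto
    have "cmod (coeff_at0 n (strip_map \<theta>)) = sin (N * \<theta>) / (N * sin \<theta>)"
      using coeff_at0_strip_map[OF t(1,3), of m] sn(2) s N
      unfolding m[symmetric] N_def[symmetric] by (simp only: norm_of_real) simp
    moreover have "cmod (coeff_at0 (Suc n) (strip_map \<theta>)) = sin ((N + 1) * \<theta>) / ((N + 1) * sin \<theta>)"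
    proof -
      have "real (Suc n) = N + 1" by (simp add: N_def)
      then show ?thesis
        using coeff_at0_strip_map[OF t(1,3), of n] sn(1) s N by (simp only: norm_of_real) simp
    qed
    ultimately show ?thesis by (simp add: E_def)
  qed
  have "E \<theta>0 = 1 / N" unfolding E_def Nt using s0 by simp
  then have "1 / N < E \<theta>" using d(2)[OF h(1,2)] by (simp add: \<theta>_def)
  then have "ereal (1 / real n) < ereal (cmod (coeff_at0 n (strip_map \<theta>)) - cmod (coeff_at0 (Suc n) (strip_map \<theta>)))"
    unfolding val by (simp add: N_def)
  also have "\<dots> \<le> V n"
    unfolding V_def by (intro SUP_upper strip_map_convex_class t)
  finally show ?thesis .
qed

theorem theorem2:
  fixes n :: nat
  assumes "n \<ge> 4"
  shows "ereal (1 / real n) < V n \<and> V n < ereal (2 / (real n + 1))"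
  using V_greater[OF assms] V_less[of n] assms by simp

end
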